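(* Let $1\le k\le n$ be integers, $\rho\in(0,1)$, and let $\mathcal{C}$ be any nonempty class of subsets of $\{1,\dots,n\}$, each of size $k$. Let $R^*$ be the Bayes risk (defined in the context) for testing $X\sim\mathcal N(0,\mathbf I)$ against the uniform mixture of $\mathcal N(0,\mathbf A_S)$, $S\in\mathcal C$. Let $Z=|S\cap S'|$ where $S,S'$ are drawn independently and uniformly at random from $\mathcal C$. Then for every $a>0$, $$R^*\ \ge\ \mathbf P\{|\mathcal N(0,1)|\le a\}\left(1-\tfrac12\sqrt{\mathbf E\exp(\nu_a Z)-1}\right),\qquad \nu_a:=\frac{\rho a^2}{1+\rho}-\tfrac12\log(1-\rho^2).$$ In particular (taking $a=1$), $$R^*\ \ge\ 0.6-0.3\sqrt{\mathbf E\exp(\nu_1 Z)-1},\qquad \nu_1=\nu(\rho):=\frac{\rho}{1+\rho}-\tfrac12\log(1-\rho^2).$$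
   Context: For $S\subset\{1,\dots,n\}$ with $|S|=k$, $\mathbf A_S$ is the $n\times n$ matrix with $(\mathbf A_S)_{i,i}=1$, $(\mathbf A_S)_{i,j}=\rho$ for $i\ne j$ with $i,j\in S$, and $(\mathbf A_S)_{i,j}=0$ otherwise. $\mathbb P_0$ is the law of $X\sim\mathcal N(0,\mathbf I)$ on $\mathbb R^n$ and $\mathbb P_S$ the law of $X\sim\mathcal N(0,\mathbf A_S)$. A test is a measurable function $f:\mathbb R^n\to\{0,1\}$. Its average risk is $R(f)=\mathbb P_0\{f(X)=1\}+\frac1{|\mathcal C|}\sum_{S\in\mathcal C}\mathbb P_S\{f(X)=0\}$, and the Bayes risk is $R^*=\inf_f R(f)$. $\mathbf P\{|\mathcal N(0,1)|\le a\}$ denotes the probability that a standard normal variable has absolute value at most $a$. *)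

theory Defs
  imports "HOL-Probability.Probability"
begin

(* The density involves A^{-1} and det A, so this is the law N(m, A) only for a
   symmetric positive definite A. *)
definition mvn_density :: "real^'n \<Rightarrow> real^'n^'n \<Rightarrow> real^'n \<Rightarrow> real" where
  "mvn_density m A x =
     exp (- ((x - m) \<bullet> (matrix_inv A *v (x - m))) / 2) / sqrt ((2 * pi) ^ CARD('n) * det A)"

definition mvn :: "real^'n \<Rightarrow> real^'n^'n \<Rightarrow> (real^'n) measure" where
  "mvn m A = density lborel (\<lambda>x. ennreal (mvn_density m A x))"

(* The type 'n plays the role of the index set {1..n}, with n = CARD('n).
   The matrices below are positive definite for 0 \<le> \<rho> < 1. *)
definition corr_matrix :: "real \<Rightarrow> ('n::finite) set \<Rightarrow> real^'n^'n" where
  "corr_matrix \<rho> S = (\<chi> i j. if i = j then 1 else if i \<in> S \<and> j \<in> S then \<rho> else 0)"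

definition null_law :: "(real^'n) measure" where
  "null_law = mvn 0 (mat 1)"

definition alt_law :: "real \<Rightarrow> ('n::finite) set \<Rightarrow> (real^'n) measure" where
  "alt_law \<rho> S = mvn 0 (corr_matrix \<rho> S)"

(* Measurability into count_space {0, 1} also forces a test to take values in {0, 1}. *)
definition tests :: "(real^'n \<Rightarrow> nat) set" where
  "tests = measurable borel (count_space {0, 1})"

definition average_risk :: "real \<Rightarrow> ('n::finite) set set \<Rightarrow> (real^'n \<Rightarrow> nat) \<Rightarrow> real" where
  "average_risk \<rho> C f =
     measure null_law {x. f x = 1}
       + (1 / real (card C)) * (\<Sum>S\<in>C. measure (alt_law \<rho> S) {x. f x = 0})"

definition bayes_risk :: "real \<Rightarrow> ('n::finite) set set \<Rightarrow> real" where
  "bayes_risk \<rho> C = (INF f\<in>tests. average_risk \<rho> C f)"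

(* The law of Z = |S \<inter> S'| for S, S' independent and uniform on C. *)
definition overlap_pmf :: "'n set set \<Rightarrow> nat pmf" where
  "overlap_pmf C =
     map_pmf (\<lambda>(S, S'). card (S \<inter> S')) (pair_pmf (pmf_of_set C) (pmf_of_set C))"

definition nu :: "real \<Rightarrow> real \<Rightarrow> real" where
  "nu \<rho> a = \<rho> * a\<^sup>2 / (1 + \<rho>) - ln (1 - \<rho>\<^sup>2) / 2"

end

theory Submission
  imports Defs
begin

text \<open>
  Under \<open>alt_law \<rho> S\<close> the coordinates in \<open>S\<close> can be written as
  \<open>X\<^sub>i = sqrt \<rho> * U + sqrt (1 - \<rho>) * Y\<^sub>i\<close>, where the latent variable \<open>U\<close> and the \<open>Y\<^sub>i\<close> are independent
  standard normal. Conditionally on \<open>U = u\<close> the coordinates are independent, the risk of every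
  test is nonnegative, and it is at least 1 minus half the square root of the chi-square
  divergence of the mixture. That divergence is \<open>E exp (nu \<rho> u * Z) - 1\<close>, which is largest at
  \<open>\<bar>u\<bar> = a\<close> on \<open>\<bar>u\<bar> \<le> a\<close>. Averaging over \<open>U\<close> and dropping \<open>\<bar>u\<bar> > a\<close> gives the bound.
\<close>

section \<open>Diagonal plus rank-one matrices\<close>

text \<open>The matrix determinant lemma. The identity rows \<open>e i\<close> are changed to
  \<open>e i + u i *s w\<close> one at a time. Linearity in row \<open>k\<close> adds to the
  previous determinant \<open>u k\<close> times one whose row \<open>k\<close> is \<open>w\<close>,
  and the latter equals \<open>v k\<close>.\<close>

lemma det_identity_plus_rank_one:
  fixes u v :: "'n::finite \<Rightarrow> 'a::field"
  shows "det (\<chi> i j. (if i = j then 1 else 0) + u i * v j) = 1 + (\<Sum>i\<in>UNIV. u i * v i)"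
proof -
  define e :: "'n \<Rightarrow> 'a^'n" where "e i = axis i 1" for i
  define w :: "'a^'n" where "w = vec_lambda v"
  \<comment> \<open>Cramer's rule for the identity matrix: replacing row \<open>k\<close> by
    \<open>w\<close> gives the \<open>k\<close>-th coordinate of \<open>w\<close>.\<close>
  have cramer: "det (\<chi> i. if i = k then w else e i) = v k" for k
  proof -
    have "(\<Sum>i\<in>UNIV. w $ i *s row i (mat 1)) = w"
      by (simp add: vec_eq_iff row_def mat_def if_distrib cong: if_cong)
    moreover have "row i (mat 1) = e i" for i
      by (simp add: vec_eq_iff row_def mat_def e_def axis_def)
    ultimately have "det (\<chi> i. if i = k then w else e i) = w $ k * det (mat 1 :: 'a^'n^'n)"
      using cramer_lemma_transpose[of k w "mat 1"] by (simp only:)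
    then show ?thesis
      by (simp add: w_def)
  qed
  \<comment> \<open>Once row \<open>k\<close> is \<open>w\<close>, adding \<open>u j *s w\<close> to
    another row \<open>j\<close> is a row operation and preserves the determinant. Hence the rows
    already changed may be treated as unchanged.\<close>
  have elim: "det (\<chi> i. if i = k then w else if i \<in> T then e i + u i *s w else e i) = v k"
    if "finite T" "k \<notin> T" for k T
    using that
  proof (induction T rule: finite_induct)
    case empty
    then show ?case using cramer by (simp cong: if_cong)
  next
    case (insert j T)
    let ?A = "(\<chi> i. if i = k then w else if i \<in> T then e i + u i *s w else e i) :: 'a^'n^'n"
    have "(\<chi> i. if i = j then row j ?A + u j *s row k ?A else row i ?A) =
        (\<chi> i. if i = k then w else if i \<in> insert j T then e i + u i *s w else e i)"
      using insert.hyps insert.prems by (auto simp: vec_eq_iff row_def)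
    then show ?case
      using det_row_operation[of j k ?A "u j"] insert by auto
  qed
  have "det (\<chi> i. if i \<in> T then e i + u i *s w else e i) = 1 + (\<Sum>i\<in>T. u i * v i)"
    if "finite T" for T
    using that
  proof (induction T rule: finite_induct)
    case empty
    have "(\<chi> i. e i) = mat 1"
      by (simp add: vec_eq_iff mat_def e_def axis_def)
    then show ?case by simp
  next
    case (insert k T)
    let ?c = "\<lambda>i. if i \<in> T then e i + u i *s w else e i"
    have "(\<chi> i. if i \<in> insert k T then e i + u i *s w else e i) =
        (\<chi> i. if i = k then e i + u i *s w else ?c i)"
      by (simp add: vec_eq_iff)
    also have "det \<dots> = det (\<chi> i. if i = k then e i else ?c i) +
        det (\<chi> i. if i = k then u i *s w else ?c i)"
      by (rule det_row_add)
    also have "(\<chi> i. if i = k then e i else ?c i) = (\<chi> i. ?c i)"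
      using insert.hyps by (simp add: vec_eq_iff)
    also have "(\<chi> i. if i = k then u i *s w else ?c i) = (\<chi> i. if i = k then u k *s w else ?c i)"
      by (simp add: vec_eq_iff)
    also have "det \<dots> = u k * det (\<chi> i. if i = k then w else ?c i)"
      by (rule det_row_mul)
    finally show ?case
      using insert elim[of T k] by simp
  qed
  from this[of UNIV] have "det (\<chi> i. e i + u i *s w) = 1 + (\<Sum>i\<in>UNIV. u i * v i)"
    by simp
  moreover have "(\<chi> i. e i + u i *s w) = (\<chi> i j. (if i = j then 1 else 0) + u i * v j)"
    by (simp add: vec_eq_iff e_def w_def axis_def)
  ultimately show ?thesis by simp
qed

text \<open>Pulling the factor \<open>d i\<close> out of row \<open>i\<close> leaves the identity
  plus a rank-one matrix with \<open>u i / d i\<close> in place of \<open>u i\<close>.\<close>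

lemma det_diagonal_plus_rank_one:
  fixes d u v :: "'n::finite \<Rightarrow> 'a::field"
  assumes "\<And>i. d i \<noteq> 0"
  shows "det (\<chi> i j. (if i = j then d i else 0) + u i * v j) =
    (\<Prod>i\<in>UNIV. d i) * (1 + (\<Sum>i\<in>UNIV. u i * v i / d i))"
proof -
  have "(\<chi> i j. (if i = j then d i else 0) + u i * v j) =
      (\<chi> i. d i *s (\<chi> j. (if i = j then 1 else 0) + u i / d i * v j))"
    using assms by (simp add: vec_eq_iff field_simps)
  then show ?thesis
    using det_identity_plus_rank_one[of "\<lambda>i. u i / d i" v] by (simp add: det_rows_mul)
qed

text \<open>A right inverse of a square matrix over a field is two-sided, so \<open>A\<close> is
  invertible, the value chosen by \<open>matrix_inv\<close> is a left inverse, and associativity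
  identifies it with \<open>B\<close>.\<close>

lemma matrix_inv_eqI:
  fixes A B :: "'a::field^'n^'n"
  assumes "A ** B = mat 1"
  shows "matrix_inv A = B"
proof -
  have "B ** A = mat 1"
    using assms matrix_left_right_inverse by blast
  then have "invertible A"
    using assms by (auto simp: invertible_def)
  then have "matrix_inv A ** A = mat 1"
    unfolding invertible_def matrix_inv_def by (rule someI2_ex) simp
  then have "(matrix_inv A ** A) ** B = B"
    by simp
  then show ?thesis
    using assms by (simp flip: matrix_mul_assoc)
qed

text \<open>The Sherman-Morrison formula, checked by multiplying out.\<close>

lemma matrix_inv_diagonal_plus_rank_one:
  fixes d u v :: "'n::finite \<Rightarrow> 'a::field"
  assumes "\<And>i. d i \<noteq> 0" and "1 + (\<Sum>i\<in>UNIV. u i * v i / d i) \<noteq> 0"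
  shows "matrix_inv (\<chi> i j. (if i = j then d i else 0) + u i * v j) =
    (\<chi> i j. (if i = j then 1 / d i else 0)
       - u i * v j / (d i * d j * (1 + (\<Sum>i\<in>UNIV. u i * v i / d i))))"
    (is "matrix_inv ?A = ?B")
proof (rule matrix_inv_eqI)
  define s where "s = (\<Sum>i\<in>UNIV. u i * v i / d i)"
  have s: "1 + s \<noteq> 0" using assms(2) by (simp add: s_def)
  have "(?A ** ?B) $ i $ j = mat 1 $ i $ j" for i j
  proof -
    \<comment> \<open>\<open>c\<close> gathers the factors that do not depend on the summation
      index, so column \<open>j\<close> of the candidate inverse is a unit vector over
      \<open>d j\<close> minus \<open>c\<close> times the vector \<open>u / d\<close>.\<close>
    define c where "c = v j / (d j * (1 + s))"
    have "(?A ** ?B) $ i $ j = (\<Sum>l\<in>UNIV. ((if i = l then d i else 0) + u i * v l) *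
        ((if l = j then 1 / d l else 0) - u l / d l * c))"
      by (simp add: matrix_matrix_mult_def c_def mult.assoc flip: s_def)
    also have "\<dots> = (\<Sum>l\<in>UNIV. (if i = l then (if l = j then 1 else 0) - u l * c else 0)
        + (if l = j then u i * v l / d l else 0) - u i * c * (u l * v l / d l))"
      by (rule sum.cong) (use assms(1) in \<open>auto simp: algebra_simps\<close>)
    also have "\<dots> = (if i = j then 1 else 0) - u i * c + u i * v j / d j - u i * c * s"
      by (simp add: sum.distrib sum_subtractf s_def sum_distrib_left)
    also have "\<dots> = (if i = j then 1 else 0) + u i * (v j / d j - c * (1 + s))"
      by (simp add: algebra_simps)
    also have "v j / d j - c * (1 + s) = 0"
      using s by (simp add: c_def)
    also have "(if i = j then 1 else 0) + u i * 0 = (if i = j then 1 else 0)"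
      by simp
    finally show ?thesis by (simp add: mat_def)
  qed
  then show "?A ** ?B = mat 1" by (simp add: vec_eq_iff)
qed

section \<open>Gaussian densities and the latent variable\<close>

text \<open>This puts the covariance into diagonal plus rank-one form, so that its determinant and
  inverse become explicit.\<close>

lemma corr_matrix_eq:
  "corr_matrix \<rho> S = (\<chi> i j. (if i = j then (if i \<in> S then 1 - \<rho> else 1) else 0)
     + (\<rho> * indicator S i) * indicator S j)"
  by (auto simp: corr_matrix_def vec_eq_iff indicator_def)

text \<open>\<open>\<sigma>\<close> is the scalar
  \<open>1 + (\<Sum>i\<in>UNIV. u i * v i / d i)\<close> of the rank-one formulas. It enters the
  determinant as a factor, and the quadratic form through the inverse.\<close>

lemma mvn_density_corr_matrix:
  fixes S :: "'n::finite set" and x :: "real^'n"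
  assumes "0 \<le> \<rho>" "\<rho> < 1"
  defines "\<sigma> \<equiv> 1 + real (card S) * \<rho> / (1 - \<rho>)"
  shows "mvn_density 0 (corr_matrix \<rho> S) x =
    exp (- ((\<Sum>i\<in>-S. (x $ i)\<^sup>2) + (\<Sum>i\<in>S. (x $ i)\<^sup>2) / (1 - \<rho>)
        - \<rho> / ((1 - \<rho>)\<^sup>2 * \<sigma>) * (\<Sum>i\<in>S. x $ i)\<^sup>2) / 2)
      / sqrt ((2 * pi) ^ CARD('n) * ((1 - \<rho>) ^ card S * \<sigma>))"
proof -
  define d where "d i = (if i \<in> S then 1 - \<rho> else 1)" for i
  have d: "d i \<noteq> 0" for i using assms by (simp add: d_def)
  have trace: "1 + (\<Sum>i\<in>UNIV. (\<rho> * indicator S i) * indicator S i / d i) = \<sigma>"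
  proof -
    have "(\<Sum>i\<in>UNIV. (\<rho> * indicator S i) * indicator S i / d i) = (\<Sum>i\<in>S. \<rho> / (1 - \<rho>))"
      by (rule sum.mono_neutral_cong_right) (auto simp: d_def)
    then show ?thesis by (simp add: \<sigma>_def)
  qed
  have "\<sigma> > 0" using assms(1,2) by (simp add: \<sigma>_def add_pos_nonneg)
  have A: "corr_matrix \<rho> S = (\<chi> i j. (if i = j then d i else 0) + (\<rho> * indicator S i) * indicator S j)"
    unfolding corr_matrix_eq d_def ..
  have "det (corr_matrix \<rho> S) = (\<Prod>i\<in>UNIV. d i) * \<sigma>"
    unfolding A det_diagonal_plus_rank_one[OF d] trace ..
  also have "(\<Prod>i\<in>UNIV. d i) = (\<Prod>i\<in>S. 1 - \<rho>)"
    by (rule prod.mono_neutral_cong_right) (auto simp: d_def)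
  finally have det: "det (corr_matrix \<rho> S) = (1 - \<rho>) ^ card S * \<sigma>" by simp
  have inv: "matrix_inv (corr_matrix \<rho> S) = (\<chi> i j. (if i = j then 1 / d i else 0)
       - (\<rho> * indicator S i) * indicator S j / (d i * d j * \<sigma>))"
    using matrix_inv_diagonal_plus_rank_one[of d "\<lambda>i. \<rho> * indicator S i" "indicator S"]
      d \<open>\<sigma> > 0\<close> unfolding A trace by simp
  have "x \<bullet> (matrix_inv (corr_matrix \<rho> S) *v x) =
      (\<Sum>i\<in>UNIV. (x $ i)\<^sup>2 / d i - (x $ i * indicator S i / d i) * (\<rho> / \<sigma>) * (\<Sum>j\<in>UNIV. x $ j * indicator S j / d j))"
    unfolding inner_vec_def inner_real_def
  proof (rule sum.cong)
    fix i
    have "(matrix_inv (corr_matrix \<rho> S) *v x) $ i = (\<Sum>j\<in>UNIV. (if i = j then x $ i / d i else 0)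
        - (indicator S i / d i) * (\<rho> / \<sigma>) * (x $ j * indicator S j / d j))"
      unfolding matrix_vector_mult_def inv by (auto intro!: sum.cong simp: algebra_simps)
    also have "\<dots> = x $ i / d i - (indicator S i / d i) * (\<rho> / \<sigma>) * (\<Sum>j\<in>UNIV. x $ j * indicator S j / d j)"
      by (simp add: sum_subtractf sum_distrib_left)
    finally have *: "(matrix_inv (corr_matrix \<rho> S) *v x) $ i =
        x $ i / d i - (indicator S i / d i) * (\<rho> / \<sigma>) * (\<Sum>j\<in>UNIV. x $ j * indicator S j / d j)" .
    show "x $ i * (matrix_inv (corr_matrix \<rho> S) *v x) $ i =
        (x $ i)\<^sup>2 / d i - (x $ i * indicator S i / d i) * (\<rho> / \<sigma>) * (\<Sum>j\<in>UNIV. x $ j * indicator S j / d j)"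
      unfolding * by (simp add: right_diff_distrib power2_eq_square)
  qed simp
  also have "\<dots> = (\<Sum>i\<in>UNIV. (x $ i)\<^sup>2 / d i) - \<rho> / \<sigma> * (\<Sum>j\<in>UNIV. x $ j * indicator S j / d j)\<^sup>2"
    by (simp only: sum_subtractf sum_distrib_right[symmetric]) (simp add: power2_eq_square)
  also have "(\<Sum>j\<in>UNIV. x $ j * indicator S j / d j) = (\<Sum>j\<in>S. x $ j / (1 - \<rho>))"
    by (rule sum.mono_neutral_cong_right) (auto simp: d_def)
  also have "\<dots> = (\<Sum>j\<in>S. x $ j) / (1 - \<rho>)"
    by (simp add: sum_divide_distrib)
  also have "(\<Sum>i\<in>UNIV. (x $ i)\<^sup>2 / d i) = (\<Sum>i\<in>-S. (x $ i)\<^sup>2 / d i) + (\<Sum>i\<in>S. (x $ i)\<^sup>2 / d i)"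
    by (subst sum.union_disjoint[symmetric]) auto
  also have "\<dots> = (\<Sum>i\<in>-S. (x $ i)\<^sup>2) + (\<Sum>i\<in>S. (x $ i)\<^sup>2) / (1 - \<rho>)"
    by (simp add: d_def sum_divide_distrib)
  finally have quad: "x \<bullet> (matrix_inv (corr_matrix \<rho> S) *v x) =
      (\<Sum>i\<in>-S. (x $ i)\<^sup>2) + (\<Sum>i\<in>S. (x $ i)\<^sup>2) / (1 - \<rho>)
        - \<rho> / ((1 - \<rho>)\<^sup>2 * \<sigma>) * (\<Sum>i\<in>S. x $ i)\<^sup>2"
    by (simp add: power_divide mult.commute)
  show ?thesis
    unfolding mvn_density_def det by (simp add: quad)
qed

text \<open>Likelihood ratio of one coordinate in \<open>S\<close>, conditional on \<open>U = u\<close>, against the null law.\<close>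

definition lr :: "real \<Rightarrow> real \<Rightarrow> real \<Rightarrow> real" where
  "lr \<rho> u t = normal_density (sqrt \<rho> * u) (sqrt (1 - \<rho>)) t / std_normal_density t"

lemma lr_nonneg: "0 \<le> lr \<rho> u t"
  by (simp add: lr_def)

text \<open>Bayes' rule for the latent variable: the joint density of \<open>U\<close> and
  \<open>X\<close> is the marginal density of \<open>X\<close> times the conditional density of
  \<open>U\<close> given \<open>X = x\<close>, which is normal with variance
  \<open>1 / \<sigma>\<close>. Integrating out \<open>u\<close> then leaves the density of the
  alternative. The proof completes the square in \<open>u\<close>.\<close>

lemma std_normal_mixture_eq_mvn_density:
  fixes S :: "'n::finite set" and x :: "real^'n"
  assumes "0 < \<rho>" "\<rho> < 1"
  defines "\<sigma> \<equiv> 1 + real (card S) * \<rho> / (1 - \<rho>)"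
  shows "std_normal_density u * ((\<Prod>i\<in>S. lr \<rho> u (x $ i)) * (\<Prod>i\<in>UNIV. std_normal_density (x $ i)))
    = mvn_density 0 (corr_matrix \<rho> S) x *
        normal_density (sqrt \<rho> * (\<Sum>i\<in>S. x $ i) / ((1 - \<rho>) * \<sigma>)) (sqrt (1 / \<sigma>)) u"
proof -
  define s where "s = (\<Sum>i\<in>S. x $ i)"
  define q where "q = (\<Sum>i\<in>S. (x $ i)\<^sup>2)"
  define r where "r = (\<Sum>i\<in>-S. (x $ i)\<^sup>2)"
  define k where "k = real (card S)"
  have \<sigma>: "\<sigma> > 0" using assms(1,2) by (simp add: \<sigma>_def add_pos_nonneg)
  have n: "CARD('n) = card S + card (-S)"
    by (subst card_Un_disjoint[symmetric]) auto
  have "(\<Prod>i\<in>UNIV. std_normal_density (x $ i)) =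
      (\<Prod>i\<in>S. std_normal_density (x $ i)) * (\<Prod>i\<in>-S. std_normal_density (x $ i))"
    by (subst prod.union_disjoint[symmetric]) auto
  then have "(\<Prod>i\<in>S. lr \<rho> u (x $ i)) * (\<Prod>i\<in>UNIV. std_normal_density (x $ i)) =
      (\<Prod>i\<in>S. lr \<rho> u (x $ i) * std_normal_density (x $ i)) * (\<Prod>i\<in>-S. std_normal_density (x $ i))"
    by (simp add: prod.distrib)
  also have "(\<Prod>i\<in>S. lr \<rho> u (x $ i) * std_normal_density (x $ i)) =
      (\<Prod>i\<in>S. normal_density (sqrt \<rho> * u) (sqrt (1 - \<rho>)) (x $ i))"
    using normal_density_pos[of 1 0] by (simp add: lr_def less_imp_neq[symmetric])
  also have "\<dots> = (1 / sqrt (2 * pi * (1 - \<rho>))) ^ card S *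
      exp (\<Sum>i\<in>S. - (x $ i - sqrt \<rho> * u)\<^sup>2 / (2 * (1 - \<rho>)))"
    using assms by (simp add: normal_density_def prod_dividef exp_sum power_one_over)
  also have "(\<Sum>i\<in>S. - (x $ i - sqrt \<rho> * u)\<^sup>2 / (2 * (1 - \<rho>))) =
      - (q - 2 * sqrt \<rho> * u * s + k * (\<rho> * u\<^sup>2)) / (2 * (1 - \<rho>))"
  proof -
    have "(\<Sum>i\<in>S. (x $ i - sqrt \<rho> * u)\<^sup>2) = (\<Sum>i\<in>S. (x $ i)\<^sup>2 - 2 * sqrt \<rho> * u * x $ i + \<rho> * u\<^sup>2)"
      using assms by (intro sum.cong) (simp_all add: power2_diff power_mult_distrib algebra_simps)
    also have "\<dots> = q - 2 * sqrt \<rho> * u * s + k * (\<rho> * u\<^sup>2)"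
      by (simp add: sum.distrib sum_subtractf q_def s_def k_def flip: sum_distrib_left)
    finally show ?thesis
      by (simp only: sum_negf sum_divide_distrib[symmetric])
  qed
  also have "(\<Prod>i\<in>-S. std_normal_density (x $ i)) = (1 / sqrt (2 * pi)) ^ card (-S) * exp (- r / 2)"
    by (simp add: normal_density_def prod_dividef power_one_over r_def sum_negf sum_divide_distrib flip: exp_sum)
  finally have prod: "(\<Prod>i\<in>S. lr \<rho> u (x $ i)) * (\<Prod>i\<in>UNIV. std_normal_density (x $ i)) =
     (1 / sqrt (2 * pi * (1 - \<rho>))) ^ card S *
       exp (- (q - 2 * sqrt \<rho> * u * s + k * (\<rho> * u\<^sup>2)) / (2 * (1 - \<rho>))) *
     ((1 / sqrt (2 * pi)) ^ card (-S) * exp (- r / 2))" .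
  have L: "std_normal_density u * ((\<Prod>i\<in>S. lr \<rho> u (x $ i)) * (\<Prod>i\<in>UNIV. std_normal_density (x $ i))) =
     1 / (sqrt (2 * pi) * sqrt (2 * pi * (1 - \<rho>)) ^ card S * sqrt (2 * pi) ^ card (-S)) *
     exp (- u\<^sup>2 / 2 + (- (q - 2 * sqrt \<rho> * u * s + k * (\<rho> * u\<^sup>2)) / (2 * (1 - \<rho>))) + - r / 2)"
    unfolding prod unfolding std_normal_density_def power_one_over exp_add by simp
  have sq: "(u - sqrt \<rho> * s / ((1 - \<rho>) * \<sigma>))\<^sup>2 =
      u\<^sup>2 - 2 * (sqrt \<rho> * s / ((1 - \<rho>) * \<sigma>)) * u + \<rho> * s\<^sup>2 / ((1 - \<rho>)\<^sup>2 * \<sigma>\<^sup>2)"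
    using assms(1) by (simp add: power2_diff power_divide power_mult_distrib mult_ac)
  \<comment> \<open>This removes \<open>k\<close> from the coefficient of \<open>u\<^sup>2\<close>:
    \<open>1 + k * \<rho> / (1 - \<rho>)\<close> is exactly \<open>\<sigma>\<close>, the precision
    of \<open>U\<close> given \<open>x\<close>.\<close>
  have ks: "k * \<rho> = (\<sigma> - 1) * (1 - \<rho>)" using assms by (simp add: \<sigma>_def k_def)
  have R: "mvn_density 0 (corr_matrix \<rho> S) x * normal_density (sqrt \<rho> * s / ((1 - \<rho>) * \<sigma>)) (sqrt (1 / \<sigma>)) u =
     1 / (sqrt ((2 * pi) ^ CARD('n) * ((1 - \<rho>) ^ card S * \<sigma>)) * sqrt (2 * pi / \<sigma>)) *
     exp (- (r + q / (1 - \<rho>) - \<rho> / ((1 - \<rho>)\<^sup>2 * \<sigma>) * s\<^sup>2) / 2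
       + - (u - sqrt \<rho> * s / ((1 - \<rho>) * \<sigma>))\<^sup>2 / (2 / \<sigma>))"
    unfolding mvn_density_corr_matrix[OF less_imp_le[OF assms(1)] assms(2), of S x, folded \<sigma>_def s_def q_def r_def]
      normal_density_def exp_add using \<sigma> by simp
  \<comment> \<open>The normalising constants agree: \<open>\<sigma>\<close> from the determinant
    cancels against the variance \<open>1 / \<sigma>\<close>, and the extra factor
    \<open>2 * pi\<close> belongs to \<open>u\<close>.\<close>
  have c: "sqrt ((2 * pi) ^ CARD('n) * ((1 - \<rho>) ^ card S * \<sigma>)) * sqrt (2 * pi / \<sigma>) =
      sqrt (2 * pi) * sqrt (2 * pi * (1 - \<rho>)) ^ card S * sqrt (2 * pi) ^ card (-S)"
    using \<sigma> by (simp add: n power_add power_mult_distrib flip: real_sqrt_mult real_sqrt_power)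
  have e: "- u\<^sup>2 / 2 + (- (q - 2 * sqrt \<rho> * u * s + k * (\<rho> * u\<^sup>2)) / (2 * (1 - \<rho>))) + - r / 2 =
     - (r + q / (1 - \<rho>) - \<rho> / ((1 - \<rho>)\<^sup>2 * \<sigma>) * s\<^sup>2) / 2
       + - (u - sqrt \<rho> * s / ((1 - \<rho>) * \<sigma>))\<^sup>2 / (2 / \<sigma>)"
  proof -
    define D where "D = 1 - \<rho>"
    have D: "D > 0" using assms by (simp add: D_def)
    have kk: "k * (\<rho> * u\<^sup>2) = (\<sigma> - 1) * D * u\<^sup>2" using ks by (simp add: D_def flip: mult.assoc)
    show ?thesis
      unfolding sq kk D_def[symmetric] using D \<sigma> assms(1) by (simp add: field_simps power2_eq_square)
  qed
  show ?thesis
    unfolding s_def[symmetric] L R c e ..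
qed

text \<open>Squaring the conditional density and dividing by the standard one gives precision
  \<open>2 / (1 - \<rho>) - 1 = (1 + \<rho>) / (1 - \<rho>)\<close>, hence again a Gaussian up to a
  constant. That constant is \<open>exp (nu \<rho> u)\<close>, the second moment of
  \<open>lr\<close> under the null law.\<close>

lemma normal_chi_square_term:
  assumes "0 < \<rho>" "\<rho> < 1"
  shows "std_normal_density t * (lr \<rho> u t)\<^sup>2 =
    exp (nu \<rho> u) * normal_density (2 * sqrt \<rho> * u / (1 + \<rho>)) (sqrt ((1 - \<rho>) / (1 + \<rho>))) t"
proof -
  define m where "m = sqrt \<rho> * u"
  define D where "D = 1 - \<rho>"
  define E where "E = 1 + \<rho>"
  have D: "D > 0" "E > 0" "E = 2 - D" using assms by (simp_all add: D_def E_def)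
  have m: "\<rho> * u\<^sup>2 = m\<^sup>2" using assms by (simp add: m_def power_mult_distrib)
  have DE: "1 - \<rho>\<^sup>2 = D * E" by (simp add: D_def E_def power2_eq_square algebra_simps)
  have "exp (- ln (1 - \<rho>\<^sup>2) / 2) = 1 / sqrt (D * E)"
    using D by (simp add: DE exp_minus ln_sqrt[symmetric] field_simps)
  then have nu: "exp (nu \<rho> u) = exp (m\<^sup>2 / E) / sqrt (D * E)"
    using exp_add[of "m\<^sup>2 / E" "- ln (1 - \<rho>\<^sup>2) / 2"] by (simp add: nu_def m E_def)
  have "std_normal_density t * (lr \<rho> u t)\<^sup>2 = (normal_density m (sqrt D) t)\<^sup>2 / std_normal_density t"
    using normal_density_pos[of 1 0 t]
    by (simp add: lr_def m_def D_def power2_eq_square)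
  also have "\<dots> = sqrt (2 * pi) / (2 * pi * D) * exp (- (t - m)\<^sup>2 / D + t\<^sup>2 / 2)"
  proof -
    have "(normal_density m (sqrt D) t)\<^sup>2 = exp (- (t - m)\<^sup>2 / D) / (2 * pi * D)"
      using D by (simp add: normal_density_def power_divide power_mult_distrib flip: exp_double)
    moreover have "1 / std_normal_density t = sqrt (2 * pi) * exp (t\<^sup>2 / 2)"
      by (simp add: std_normal_density_def exp_minus field_simps)
    ultimately show ?thesis
      unfolding exp_add by (metis (no_types) divide_inverse inverse_eq_divide mult.commute mult.left_commute)
  qed
  also have "sqrt (2 * pi) / (2 * pi * D) = 1 / (sqrt (D * E) * sqrt (2 * pi * (D / E)))"
  proof -
    have "sqrt (D * E) * sqrt (2 * pi * (D / E)) = sqrt (2 * pi) * D"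
      using D(1,2) by (simp flip: real_sqrt_mult) (simp add: real_sqrt_mult)
    moreover have "sqrt (2 * pi) * sqrt (2 * pi) = 2 * pi" by simp
    ultimately show ?thesis using D(1,2) by (simp add: field_simps)
  qed
  also have "- (t - m)\<^sup>2 / D + t\<^sup>2 / 2 = m\<^sup>2 / E + - (t - 2 * m / E)\<^sup>2 / (2 * (D / E))"
  proof -
    define w where "w = m\<^sup>2 / E"
    have "E * w = m\<^sup>2" using D(2) by (simp add: w_def)
    \<comment> \<open>Since \<open>E = 2 - D\<close>, this trades the quotient \<open>w\<close> for
      a polynomial identity in which the completed square can be checked.\<close>
    then have w: "D * w = 2 * w - m\<^sup>2" by (simp add: D(3) algebra_simps)
    have "(t - 2 * m / E)\<^sup>2 / (2 * (D / E)) = (E * t\<^sup>2 - 4 * m * t + 4 * w) / (2 * D)"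
      using D(1,2) by (simp add: w_def field_simps power2_eq_square)
    then have "m\<^sup>2 / E + - (t - 2 * m / E)\<^sup>2 / (2 * (D / E)) =
        w - (E * t\<^sup>2 - 4 * m * t + 4 * w) / (2 * D)"
      by (simp add: w_def)
    also have "\<dots> = (2 * (D * w) - (E * t\<^sup>2 - 4 * m * t + 4 * w)) / (2 * D)"
      using D(1) by (simp add: diff_divide_distrib)
    also have "2 * (D * w) - (E * t\<^sup>2 - 4 * m * t + 4 * w) = - (2 * (t - m)\<^sup>2) + D * t\<^sup>2"
      unfolding w D(3) by (simp add: power2_eq_square algebra_simps)
    also have "\<dots> / (2 * D) = - (t - m)\<^sup>2 / D + t\<^sup>2 / 2"
      using D(1) by (simp add: add_divide_distrib diff_divide_distrib)
    finally show ?thesis ..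
  qed
  also have "1 / (sqrt (D * E) * sqrt (2 * pi * (D / E))) * exp (m\<^sup>2 / E + - (t - 2 * m / E)\<^sup>2 / (2 * (D / E)))
      = exp (nu \<rho> u) * normal_density (2 * m / E) (sqrt (D / E)) t"
    unfolding nu normal_density_def exp_add using D by simp
  finally show ?thesis by (simp add: m_def D_def E_def mult.assoc)
qed

section \<open>Product integrals under the null law\<close>

lemma borel_measurable_vec_nth [measurable (raw)]:
  fixes f :: "'a \<Rightarrow> real^'n"
  assumes "f \<in> borel_measurable M"
  shows "(\<lambda>x. f x $ i) \<in> borel_measurable M"
  using measurable_compose[OF assms borel_measurable_nth] .

lemma borel_measurable_lr [measurable (raw)]:
  assumes [measurable]: "f \<in> borel_measurable M" "g \<in> borel_measurable M"
  shows "(\<lambda>x. lr \<rho> (f x) (g x)) \<in> borel_measurable M"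
  unfolding lr_def normal_density_def by measurable

lemma nn_integral_lborel_vec_prod:
  fixes f :: "'n::finite \<Rightarrow> real \<Rightarrow> ennreal"
  assumes "\<And>i. f i \<in> borel_measurable borel"
  shows "(\<integral>\<^sup>+x. (\<Prod>i\<in>UNIV. f i (x $ i)) \<partial>(lborel :: (real^'n) measure)) = (\<Prod>i\<in>UNIV. \<integral>\<^sup>+t. f i t \<partial>lborel)"
proof -
  have inj: "inj (\<lambda>i::'n. axis i (1::real))"
    by (simp add: inj_on_def axis_eq_axis)
  have B: "(Basis :: (real^'n) set) = range (\<lambda>i. axis i 1)"
    by (auto simp: Basis_vec_def)
  \<comment> \<open>The product formula for Lebesgue measure ranges over \<open>Basis\<close>;
    \<open>g\<close> carries \<open>f\<close> there along the injection sending \<open>i\<close> to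
    \<open>axis i 1\<close>.\<close>
  define g where "g b = f (inv (\<lambda>i::'n. axis i (1::real)) b)" for b
  have g: "g (axis i 1) = f i" for i
    by (simp add: g_def inv_f_f[OF inj])
  have "(\<integral>\<^sup>+x. (\<Prod>b\<in>Basis. g b (x \<bullet> b)) \<partial>(lborel :: (real^'n) measure)) = (\<Prod>b\<in>Basis. \<integral>\<^sup>+t. g b t \<partial>lborel)"
    by (rule nn_integral_lborel_prod) (simp_all add: g_def assms)
  then show ?thesis
    unfolding B by (simp add: prod.reindex[OF inj] g inner_axis)
qed

lemma null_law_eq:
  "(null_law :: (real^'n) measure) = density lborel (\<lambda>x. ennreal (\<Prod>i\<in>UNIV. std_normal_density (x $ i)))"
proof -
  have "matrix_inv (mat 1 :: real^'n^'n) = mat 1"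
    by (rule matrix_inv_eqI) simp
  then have "mvn_density 0 (mat 1) x = (\<Prod>i\<in>UNIV. std_normal_density (x $ i))" for x :: "real^'n"
    by (simp add: mvn_density_def std_normal_density_def prod_dividef inner_vec_def power2_eq_square
        real_sqrt_power real_sqrt_mult power_mult_distrib sum_negf sum_divide_distrib flip: exp_sum)
  then show ?thesis
    by (simp add: null_law_def mvn_def)
qed

lemma sets_null_law [measurable_cong, simp]: "sets null_law = sets borel"
  by (simp add: null_law_eq)

lemma space_null_law [simp]: "space null_law = UNIV"
  by (simp add: null_law_eq)

text \<open>Under the null law the coordinates are independent standard normals, so the integral of
  a product factors.\<close>

lemma nn_integral_null_law_prod:
  fixes f :: "'n::finite \<Rightarrow> real \<Rightarrow> real"
  assumes [measurable]: "\<And>i. f i \<in> borel_measurable borel" and "\<And>i t. 0 \<le> f i t"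
  shows "(\<integral>\<^sup>+x. ennreal (\<Prod>i\<in>UNIV. f i (x $ i)) \<partial>(null_law :: (real^'n) measure)) =
    (\<Prod>i\<in>UNIV. \<integral>\<^sup>+t. ennreal (std_normal_density t * f i t) \<partial>lborel)"
proof -
  have "(\<integral>\<^sup>+x. ennreal (\<Prod>i\<in>UNIV. f i (x $ i)) \<partial>(null_law :: (real^'n) measure)) =
    (\<integral>\<^sup>+x. (\<Prod>i\<in>UNIV. ennreal (std_normal_density (x $ i) * f i (x $ i))) \<partial>lborel)"
    unfolding null_law_eq using assms(2)
    by (subst nn_integral_density)
       (auto intro!: nn_integral_cong simp: prod.distrib prod_ennreal prod_nonneg simp flip: ennreal_mult)
  also have "\<dots> = (\<Prod>i\<in>UNIV. \<integral>\<^sup>+t. ennreal (std_normal_density t * f i t) \<partial>lborel)"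
    by (rule nn_integral_lborel_vec_prod) measurable
  finally show ?thesis .
qed

lemma nn_integral_normal_density: "\<sigma> > 0 \<Longrightarrow> (\<integral>\<^sup>+t. ennreal (normal_density m \<sigma> t) \<partial>lborel) = 1"
  by (simp add: nn_integral_eq_integral)

text \<open>The integral factors over coordinates. A coordinate in both sets contributes the second
  moment \<open>exp (nu \<rho> u)\<close>; one in a single set contributes the mass of a normal
  density, which is 1; the remaining ones also contribute 1. So only the overlap is seen. With
  \<open>T = {}\<close> the formula says that the likelihood ratio of one \<open>S\<close> has mean
  1.\<close>

lemma
  fixes S T :: "'n::finite set"
  assumes "0 < \<rho>" "\<rho> < 1"
  shows integrable_lr_prod:
      "integrable null_law (\<lambda>x. (\<Prod>i\<in>S. lr \<rho> u (x $ i)) * (\<Prod>i\<in>T. lr \<rho> u (x $ i)))"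
    and integral_lr_prod:
      "(\<integral>x. (\<Prod>i\<in>S. lr \<rho> u (x $ i)) * (\<Prod>i\<in>T. lr \<rho> u (x $ i)) \<partial>null_law) =
        exp (nu \<rho> u * real (card (S \<inter> T)))"
proof -
  define f where "f i t = (if i \<in> S then lr \<rho> u t else 1) * (if i \<in> T then lr \<rho> u t else 1)" for i t
  have f [measurable]: "f i \<in> borel_measurable borel" and f0: "0 \<le> f i t" for i t
    unfolding f_def by (auto simp: lr_nonneg)
  have eq: "(\<Prod>i\<in>S. lr \<rho> u (x $ i)) * (\<Prod>i\<in>T. lr \<rho> u (x $ i)) = (\<Prod>i\<in>UNIV. f i (x $ i))" for x
    by (simp add: f_def prod.distrib prod.If_cases)
  have one: "(\<integral>\<^sup>+t. ennreal (std_normal_density t * f i t) \<partial>lborel) =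
      ennreal (if i \<in> S \<inter> T then exp (nu \<rho> u) else 1)" for i
  proof (cases "i \<in> S \<inter> T")
    case True
    then have "std_normal_density t * f i t = exp (nu \<rho> u) *
        normal_density (2 * sqrt \<rho> * u / (1 + \<rho>)) (sqrt ((1 - \<rho>) / (1 + \<rho>))) t" for t
      using normal_chi_square_term[OF assms] by (simp add: f_def power2_eq_square)
    then show ?thesis
      using True assms by (simp add: ennreal_mult nn_integral_cmult nn_integral_normal_density)
  next
    case False
    then have "(\<forall>t. std_normal_density t * f i t = normal_density (sqrt \<rho> * u) (sqrt (1 - \<rho>)) t) \<or>
       (\<forall>t. std_normal_density t * f i t = std_normal_density t)"
      using normal_density_pos[of 1 0] by (auto simp: f_def lr_def less_imp_neq[symmetric])
    then have "(\<integral>\<^sup>+t. ennreal (std_normal_density t * f i t) \<partial>lborel) = 1"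
      using nn_integral_normal_density[of "sqrt (1 - \<rho>)" "sqrt \<rho> * u"]
        nn_integral_normal_density[of 1 0] assms
      by (elim disjE) (simp_all only:, simp_all)
    then show ?thesis
      using False by auto
  qed
  have "(\<integral>\<^sup>+x. ennreal (\<Prod>i\<in>UNIV. f i (x $ i)) \<partial>(null_law :: (real^'n) measure)) =
      ennreal (\<Prod>i\<in>UNIV. if i \<in> S \<inter> T then exp (nu \<rho> u) else 1)"
    by (simp only: nn_integral_null_law_prod f f0 one) (subst prod_ennreal, auto)
  also have "(\<Prod>i\<in>UNIV. if i \<in> S \<inter> T then exp (nu \<rho> u) else 1) = exp (nu \<rho> u * real (card (S \<inter> T)))"
    by (simp add: prod.If_cases Int_def exp_of_nat_mult mult.commute[of "nu \<rho> u"])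
  \<comment> \<open>A finite extended integral of a nonnegative function yields integrability and
    the value together.\<close>
  finally have "integrable null_law (\<lambda>x::real^'n. \<Prod>i\<in>UNIV. f i (x $ i)) \<and>
      (\<integral>x. (\<Prod>i\<in>UNIV. f i (x $ i)) \<partial>(null_law :: (real^'n) measure)) = exp (nu \<rho> u * real (card (S \<inter> T)))"
    by (subst (asm) nn_integral_eq_integrable) (auto simp: f0 prod_nonneg)
  then show "integrable null_law (\<lambda>x. (\<Prod>i\<in>S. lr \<rho> u (x $ i)) * (\<Prod>i\<in>T. lr \<rho> u (x $ i)))"
    "(\<integral>x. (\<Prod>i\<in>S. lr \<rho> u (x $ i)) * (\<Prod>i\<in>T. lr \<rho> u (x $ i)) \<partial>null_law) =
        exp (nu \<rho> u * real (card (S \<inter> T)))"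
    by (simp_all add: eq)
qed

section \<open>The alternative law as a mixture over the latent variable\<close>

lemma prob_space_null_law: "prob_space (null_law :: (real^'n::finite) measure)"
proof
  have "emeasure null_law (space null_law :: (real^'n) set) =
      (\<integral>\<^sup>+x. ennreal (\<Prod>i\<in>(UNIV :: 'n set). 1) \<partial>(null_law :: (real^'n) measure))"
    by simp
  also have "\<dots> = 1"
    by (subst nn_integral_null_law_prod) (simp_all add: nn_integral_normal_density)
  finally show "emeasure null_law (space null_law :: (real^'n) set) = 1" .
qed

interpretation null: prob_space "null_law :: (real^'n::finite) measure"
  by (rule prob_space_null_law)

interpretation std: prob_space std_normal_distribution
  by (rule prob_space_normal_density) simp

text \<open>Tonelli's theorem moves the integral over \<open>u\<close> inside. There Bayes' rule
  splits the integrand into the density of the alternative at \<open>x\<close> and a normal density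
  in \<open>u\<close>, whose integral is 1.\<close>

lemma emeasure_alt_law:
  fixes S :: "'n::finite set"
  assumes "0 < \<rho>" "\<rho> < 1" and [measurable]: "B \<in> sets borel"
  shows "emeasure (alt_law \<rho> S) B =
    (\<integral>\<^sup>+u. \<integral>\<^sup>+x. ennreal ((\<Prod>i\<in>S. lr \<rho> u (x $ i)) * indicator B x) \<partial>null_law \<partial>std_normal_distribution)"
proof -
  define \<sigma> where "\<sigma> = 1 + real (card S) * \<rho> / (1 - \<rho>)"
  have \<sigma>: "\<sigma> > 0" using assms(1,2) by (simp add: \<sigma>_def add_pos_nonneg)
  let ?L = "\<lambda>u x::real^'n. \<Prod>i\<in>S. lr \<rho> u (x $ i)"
  let ?p = "\<lambda>x::real^'n. \<Prod>i\<in>UNIV. std_normal_density (x $ i)"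
  let ?q = "\<lambda>x::real^'n. mvn_density 0 (corr_matrix \<rho> S) x"
  have q [measurable]: "?q \<in> borel_measurable borel"
    unfolding mvn_density_corr_matrix[OF less_imp_le[OF assms(1)] assms(2)] by measurable
  have q0: "0 \<le> ?q x" for x
    unfolding mvn_density_corr_matrix[OF less_imp_le[OF assms(1)] assms(2)]
    using assms(1,2) by simp
  have "(\<integral>\<^sup>+u. \<integral>\<^sup>+x. ennreal (?L u x * indicator B x) \<partial>null_law \<partial>std_normal_distribution) =
      (\<integral>\<^sup>+u. \<integral>\<^sup>+x. ennreal (std_normal_density u * (?L u x * ?p x) * indicator B x) \<partial>lborel \<partial>lborel)"
    unfolding null_law_eq
    by (subst nn_integral_density)
       (auto intro!: nn_integral_cong simp: nn_integral_density mult_ac prod_nonneg lr_nonneg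
         simp flip: nn_integral_cmult ennreal_mult)
  also have "\<dots> = (\<integral>\<^sup>+x. \<integral>\<^sup>+u. ennreal (std_normal_density u * (?L u x * ?p x) * indicator B x) \<partial>lborel \<partial>lborel)"
    by (rule lborel_pair.Fubini') simp
  also have "\<dots> = (\<integral>\<^sup>+x. ennreal (?q x) * indicator B x \<partial>lborel)"
  proof (rule nn_integral_cong)
    fix x
    have "std_normal_density u * (?L u x * ?p x) = ?q x *
        normal_density (sqrt \<rho> * (\<Sum>i\<in>S. x $ i) / ((1 - \<rho>) * \<sigma>)) (sqrt (1 / \<sigma>)) u" for u
      using std_normal_mixture_eq_mvn_density[OF assms(1,2)] by (simp add: \<sigma>_def)
    then show "(\<integral>\<^sup>+u. ennreal (std_normal_density u * (?L u x * ?p x) * indicator B x) \<partial>lborel) = ennreal (?q x) * indicator B x"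
      using \<sigma> q0[of x] by (cases "x \<in> B") (simp_all add: ennreal_mult nn_integral_cmult nn_integral_normal_density)
  qed
  also have "\<dots> = emeasure (alt_law \<rho> S) B"
    by (simp add: alt_law_def mvn_def emeasure_density)
  finally show ?thesis ..
qed

text \<open>The conditional probabilities \<open>?g u\<close> lie between 0 and 1 because the
  likelihood ratio has mean 1, so the mixture formula holds with real integrals.\<close>

lemma measure_alt_law:
  fixes S :: "'n::finite set"
  assumes "0 < \<rho>" "\<rho> < 1" and [measurable]: "B \<in> sets borel"
  shows "integrable std_normal_distribution (\<lambda>u. \<integral>x. (\<Prod>i\<in>S. lr \<rho> u (x $ i)) * indicator B x \<partial>null_law)"
    and "measure (alt_law \<rho> S) B =
      (\<integral>u. (\<integral>x. (\<Prod>i\<in>S. lr \<rho> u (x $ i)) * indicator B x \<partial>null_law) \<partial>std_normal_distribution)"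
proof -
  let ?g = "\<lambda>u. \<integral>x. (\<Prod>i\<in>S. lr \<rho> u (x $ i)) * indicator B x \<partial>null_law"
  have L: "integrable null_law (\<lambda>x. \<Prod>i\<in>S. lr \<rho> u (x $ i))" "(\<integral>x. (\<Prod>i\<in>S. lr \<rho> u (x $ i)) \<partial>null_law) = 1" for u
    using integrable_lr_prod[OF assms(1,2), where S = S and T = "{}" and u = u] integral_lr_prod[OF assms(1,2), where S = S and T = "{}" and u = u] by simp_all
  have Lind: "integrable null_law (\<lambda>x. (\<Prod>i\<in>S. lr \<rho> u (x $ i)) * indicator B x)" for u
    by (rule integrable_real_mult_indicator) (use L in auto)
  have g0: "0 \<le> ?g u" for u
    by (simp add: prod_nonneg lr_nonneg)
  have g1: "?g u \<le> 1" for u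
    unfolding L(2)[of u, symmetric]
    by (intro integral_mono Lind L) (auto simp: prod_nonneg lr_nonneg indicator_def)
  have [measurable]: "?g \<in> borel_measurable borel"
    by measurable
  show int: "integrable std_normal_distribution ?g"
    by (rule std.integrable_const_bound[where B = 1]) (auto simp: g0 g1)
  have "emeasure (alt_law \<rho> S) B = (\<integral>\<^sup>+u. ennreal (?g u) \<partial>std_normal_distribution)"
    unfolding emeasure_alt_law[OF assms]
    by (intro nn_integral_cong nn_integral_eq_integral Lind) (auto simp: prod_nonneg lr_nonneg)
  also have "\<dots> = ennreal (\<integral>u. ?g u \<partial>std_normal_distribution)"
    by (rule nn_integral_eq_integral[OF int]) (simp add: g0)
  finally show "measure (alt_law \<rho> S) B = (\<integral>u. ?g u \<partial>std_normal_distribution)"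
    by (simp add: measure_def integral_nonneg g0)
qed

section \<open>Lower bounds on the risk\<close>

text \<open>Here \<open>L\<close> is a likelihood ratio and \<open>A\<close> the rejection region.
  The total error is at least the integral of the minimum of 1 and \<open>L\<close>, that is, 1
  minus half the \<open>L1\<close> distance of \<open>L\<close> from 1, and Cauchy-Schwarz bounds
  that distance by the square root of the chi-square divergence.\<close>

lemma (in prob_space) testing_lower_bound:
  fixes L :: "'a \<Rightarrow> real"
  assumes L: "integrable M L" "integrable M (\<lambda>x. (L x)\<^sup>2)" "expectation L = 1"
    and nonneg: "\<And>x. 0 \<le> L x"
    and A [measurable]: "A \<in> events" "B \<in> events" and B: "B = space M - A"
  shows "1 - 1/2 * sqrt (expectation (\<lambda>x. (L x)\<^sup>2) - 1) \<le> prob A + expectation (\<lambda>x. L x * indicator B x)"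
proof -
  have sq: "integrable M (\<lambda>x. (L x - 1)\<^sup>2)"
    using L by (simp add: power2_diff)
  \<comment> \<open>Nonnegativity of this variance is the required case of Cauchy-Schwarz.\<close>
  have "0 \<le> variance (\<lambda>x. \<bar>L x - 1\<bar>)"
    by (rule variance_positive)
  then have "(expectation (\<lambda>x. \<bar>L x - 1\<bar>))\<^sup>2 \<le> expectation (\<lambda>x. (L x - 1)\<^sup>2)"
    using L sq by (subst (asm) variance_eq) auto
  also have "\<dots> = expectation (\<lambda>x. (L x)\<^sup>2) - 1"
    using L by (simp add: power2_diff prob_space)
  finally have "expectation (\<lambda>x. \<bar>L x - 1\<bar>) \<le> sqrt (expectation (\<lambda>x. (L x)\<^sup>2) - 1)"
    by (rule real_le_rsqrt)
  \<comment> \<open>The left integrand is \<open>min 1 (L x)\<close>; the right one is 1 on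
    \<open>A\<close> and \<open>L x\<close> on \<open>B\<close>.\<close>
  moreover have "expectation (\<lambda>x. (1 + L x - \<bar>L x - 1\<bar>) / 2) \<le> expectation (\<lambda>x. indicator A x + L x * indicator B x)"
  proof (rule integral_mono)
    show "integrable M (\<lambda>x. (1 + L x - \<bar>L x - 1\<bar>) / 2)"
      using L(1) by simp
    show "integrable M (\<lambda>x. indicator A x + L x * indicator B x)"
      using L(1) by (intro Bochner_Integration.integrable_add integrable_real_indicator
          integrable_real_mult_indicator) (simp_all add: emeasure_eq_measure)
    show "(1 + L x - \<bar>L x - 1\<bar>) / 2 \<le> indicator A x + L x * indicator B x" if "x \<in> space M" for x
      using that B nonneg[of x] by (auto simp: indicator_def)
  qed
  moreover have "expectation (\<lambda>x. (1 + L x - \<bar>L x - 1\<bar>) / 2) = 1 - expectation (\<lambda>x. \<bar>L x - 1\<bar>) / 2"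
    using L by (simp add: prob_space)
  moreover have "expectation (\<lambda>x. indicator A x + L x * indicator B x) = prob A + expectation (\<lambda>x. L x * indicator B x)"
    using L(1) by (subst Bochner_Integration.integral_add)
      (auto intro!: integrable_real_mult_indicator integrable_real_indicator simp: emeasure_eq_measure)
  ultimately show ?thesis by simp
qed

text \<open>Two independent uniform draws from \<open>C\<close> form a uniform draw from
  \<open>C \<times> C\<close>. The resulting double average has the shape of the expanded square of
  a mixture likelihood ratio.\<close>

lemma expectation_overlap_pmf:
  fixes C :: "'n::finite set set"
  assumes "C \<noteq> {}"
  shows "measure_pmf.expectation (overlap_pmf C) h =
    (\<Sum>S\<in>C. \<Sum>S'\<in>C. h (card (S \<inter> S'))) / (real (card C))\<^sup>2"
proof -
  have pmf_C: "pmf (pmf_of_set C) S = indicator C S / card C" for S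
    using assms by simp
  have "pair_pmf (pmf_of_set C) (pmf_of_set C) = pmf_of_set (C \<times> C)"
    using assms by (intro pmf_eqI) (auto simp: pmf_pair pmf_C indicator_def card_cartesian_product)
  then show ?thesis
    using assms by (simp add: overlap_pmf_def integral_pmf_of_set case_prod_unfold power2_eq_square
        card_cartesian_product sum.cartesian_product)
qed

lemma nu_mono: "0 < \<rho> \<Longrightarrow> \<bar>u\<bar> \<le> a \<Longrightarrow> nu \<rho> u \<le> nu \<rho> a"
  by (auto simp: nu_def intro!: divide_right_mono mult_left_mono abs_le_square_iff[THEN iffD1])

text \<open>On \<open>{-1..1}\<close> the bound
  \<open>exp (- x\<^sup>2 / 2) \<ge> 1 - x\<^sup>2 / 2\<close> has right side with integral
  \<open>5/3\<close>, and \<open>1 / sqrt (2 * pi) \<ge> 9/25\<close>; the product of these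
  constants is \<open>3/5\<close>.\<close>

lemma std_normal_prob_abs_le_1: "0.6 \<le> measure std_normal_distribution {x. \<bar>x\<bar> \<le> 1}"
proof -
  \<comment> \<open>Machin's formula gives
    \<open>pi / 4 = 4 * arctan (1/5) - arctan (1/239)\<close>, which is at most
    \<open>4/5\<close>.\<close>
  have "pi \<le> 16 / 5"
  proof -
    have "arctan (1/5) \<le> 1/5" by (rule arctan_le_self) simp
    moreover have "0 \<le> arctan (1/239)" by simp
    ultimately show ?thesis using machin by linarith
  qed
  then have "sqrt (2 * pi) \<le> sqrt ((25/9)\<^sup>2)"
    by (intro real_sqrt_le_mono) (simp add: power2_eq_square)
  then have "sqrt (2 * pi) \<le> 25/9" by simp
  then have c: "9/25 \<le> 1 / sqrt (2 * pi)" by (simp add: field_simps)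
  have I: "((\<lambda>x. 1 - x\<^sup>2 / 2) has_integral (5/3 :: real)) {-1..1}"
  proof -
    have "((\<lambda>x. 1 - x\<^sup>2 / 2) has_integral ((1 - 1 ^ 3 / 6) - (-1 - (-1) ^ 3 / 6) :: real)) {-1..1}"
      by (rule fundamental_theorem_of_calculus)
         (auto intro!: derivative_eq_intros simp flip: has_real_derivative_iff_has_vector_derivative)
    then show ?thesis by simp
  qed
  have eq: "{x::real. \<bar>x\<bar> \<le> 1} = {-1..1}" by auto
  have int: "set_integrable lborel {-1..1} (\<lambda>x::real. 1 - x\<^sup>2 / 2)"
    by (intro borel_integrable_atLeastAtMost') (auto intro!: continuous_intros)
  have "0.6 = 9/25 * integral {-1..1} (\<lambda>x::real. 1 - x\<^sup>2 / 2)"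
    using integral_unique[OF I] by simp
  also have "integral {-1..1} (\<lambda>x::real. 1 - x\<^sup>2 / 2) = (LINT x:{-1..1}|lborel. 1 - x\<^sup>2 / 2)"
    by (rule set_borel_integral_eq_integral(2)[OF int, symmetric])
  also have "9/25 * \<dots> = (LINT x|lborel. 9/25 * (indicator {-1..1} x * (1 - x\<^sup>2 / 2)))"
    by (simp add: set_lebesgue_integral_def)
  also have "\<dots> \<le> (LINT x|lborel. indicator {-1..1} x * std_normal_density x)"
  proof (rule integral_mono)
    show "integrable lborel (\<lambda>x. 9/25 * (indicator {-1..1} x * (1 - x\<^sup>2 / 2 :: real)))"
      using int by (simp add: set_integrable_def)
    show "integrable lborel (\<lambda>x. indicator {-1..1} x * std_normal_density x)"
      using integrable_real_mult_indicator[of "{-1..1}" lborel std_normal_density] by (simp add: mult.commute)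
    fix x :: real
    have "1 - x\<^sup>2 / 2 \<le> exp (- x\<^sup>2 / 2)"
      using exp_ge_add_one_self[of "- x\<^sup>2 / 2"] by simp
    moreover have "0 \<le> 1 - x\<^sup>2 / 2" if "x \<in> {-1..1}"
      using that abs_square_le_1[of x] by (auto simp: abs_le_iff)
    ultimately show "9/25 * (indicator {-1..1} x * (1 - x\<^sup>2 / 2)) \<le> indicator {-1..1} x * std_normal_density x"
      using c unfolding std_normal_density_def
      by (auto simp: indicator_def simp del: times_divide_eq_left intro!: mult_mono)
  qed
  also have "\<dots> = (LINT x|std_normal_distribution. indicator {-1..1} x)"
    by (subst integral_density) (simp_all add: mult.commute)
  also have "\<dots> = measure std_normal_distribution {-1..1}"
    by simp
  finally show ?thesis by (simp add: eq)
qed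

section \<open>From the conditional risk to the Bayes risk\<close>

lemma average_risk_nonneg: "0 \<le> average_risk \<rho> C f"
  by (simp add: average_risk_def sum_nonneg)

lemma bayes_risk_greatest:
  fixes C :: "'n::finite set set"
  assumes "\<And>f. f \<in> tests \<Longrightarrow> c \<le> average_risk \<rho> C f"
  shows "c \<le> bayes_risk \<rho> C"
proof -
  \<comment> \<open>A bound below an infimum of reals needs a nonempty index set; the test that
    never rejects supplies an element.\<close>
  have "(\<lambda>_. 0) \<in> (tests :: (real^'n \<Rightarrow> nat) set)"
    by (simp add: tests_def)
  then show ?thesis
    unfolding bayes_risk_def by (intro cINF_greatest assms) auto
qed

lemma average_risk_lower_bound:
  fixes C :: "'n::finite set set"
  assumes \<rho>: "0 < \<rho>" "\<rho> < 1" and C: "C \<noteq> {}" and f: "f \<in> tests"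
  shows "measure std_normal_distribution {x. \<bar>x\<bar> \<le> a} *
      (1 - 1/2 * sqrt (measure_pmf.expectation (overlap_pmf C) (\<lambda>z. exp (nu \<rho> a * real z)) - 1))
    \<le> average_risk \<rho> C f"
proof -
  define N where "N = real (card C)"
  have N: "N > 0" using C by (simp add: N_def card_gt_0_iff)
  define W where "W = {u::real. \<bar>u\<bar> \<le> a}"
  have W [measurable]: "W \<in> sets borel" unfolding W_def by measurable
  define A where "A = {x. f x = 1}"
  define B where "B = {x. f x = 0}"
  \<comment> \<open>\<open>L u\<close> is the likelihood ratio of the uniform mixture over
    \<open>C\<close>, conditional on \<open>U = u\<close>; \<open>r u\<close> below is the
    conditional average risk of \<open>f\<close>.\<close>
  define L where "L u = (\<lambda>x :: real^'n. (1 / N) * (\<Sum>S\<in>C. \<Prod>i\<in>S. lr \<rho> u (x $ i)))" for u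
  define c where "c = 1 - 1/2 * sqrt (measure_pmf.expectation (overlap_pmf C) (\<lambda>z. exp (nu \<rho> a * real z)) - 1)"
  define g where "g S u = (\<integral>x. (\<Prod>i\<in>S. lr \<rho> u (x $ i)) * indicator B x \<partial>null_law)" for S u
  define r where "r u = measure null_law A + (1 / N) * (\<Sum>S\<in>C. g S u)" for u
  have fm [measurable]: "f \<in> measurable borel (count_space {0, 1})" using f by (simp add: tests_def)
  have range: "f x = 0 \<or> f x = 1" for x
    using measurable_space[OF fm, of x] by auto
  have A [measurable]: "A \<in> sets borel"
    using measurable_sets[OF fm, of "{1}"] by (simp add: A_def vimage_def)
  have B [measurable]: "B \<in> sets borel"
    using measurable_sets[OF fm, of "{0}"] by (simp add: B_def vimage_def)
  have AB: "B = space null_law - A"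
    using range by (auto simp: A_def B_def)
  have int1: "integrable null_law (\<lambda>x. \<Prod>i\<in>S. lr \<rho> u (x $ i))"
    "(\<integral>x. (\<Prod>i\<in>S. lr \<rho> u (x $ i)) \<partial>null_law) = 1" for S :: "'n set" and u
    using integrable_lr_prod[OF \<rho>, where S = S and T = "{}" and u = u] integral_lr_prod[OF \<rho>, where S = S and T = "{}" and u = u] by simp_all
  have L2: "(L u x)\<^sup>2 = (1 / N\<^sup>2) * (\<Sum>S\<in>C. \<Sum>S'\<in>C. (\<Prod>i\<in>S. lr \<rho> u (x $ i)) * (\<Prod>i\<in>S'. lr \<rho> u (x $ i)))" for u x
    by (simp add: L_def power2_eq_square sum_product)
  have intL: "integrable null_law (L u)" "integrable null_law (\<lambda>x. (L u x)\<^sup>2)" "null.expectation (L u) = 1" for u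
    unfolding L2 using N by (simp_all add: L_def int1 integrable_lr_prod[OF \<rho>] N_def C)
  \<comment> \<open>The expanded square averages \<open>exp (nu \<rho> u * Z)\<close> over pairs
    from \<open>C\<close>, so the law of the overlap appears here.\<close>
  have EL2: "null.expectation (\<lambda>x. (L u x)\<^sup>2) = measure_pmf.expectation (overlap_pmf C) (\<lambda>z. exp (nu \<rho> u * real z))" for u
    unfolding L2 expectation_overlap_pmf[OF C]
    by (simp add: integrable_lr_prod[OF \<rho>] integral_lr_prod[OF \<rho>] N_def)
  have rL: "r u = measure null_law A + null.expectation (\<lambda>x. L u x * indicator B x)" for u
  proof -
    have *: "L u x * indicator B x = (1 / N) * (\<Sum>S\<in>C. (\<Prod>i\<in>S. lr \<rho> u (x $ i)) * indicator B x)" for x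
      unfolding L_def by (simp only: sum_distrib_right mult.assoc)
    show ?thesis
      unfolding r_def g_def * integral_mult_right_zero
      by (subst Bochner_Integration.integral_sum) (auto intro!: integrable_real_mult_indicator int1)
  qed
  have r0: "0 \<le> r u" for u
    using N by (simp add: r_def g_def sum_nonneg prod_nonneg lr_nonneg)
  have rc: "c \<le> r u" if "\<bar>u\<bar> \<le> a" for u
  proof -
    have "measure_pmf.expectation (overlap_pmf C) (\<lambda>z. exp (nu \<rho> u * real z))
        \<le> measure_pmf.expectation (overlap_pmf C) (\<lambda>z. exp (nu \<rho> a * real z))"
      unfolding expectation_overlap_pmf[OF C] using nu_mono[OF \<rho>(1) that]
      by (intro divide_right_mono sum_mono) (auto intro: mult_right_mono)
    then have "c \<le> 1 - 1/2 * sqrt (null.expectation (\<lambda>x. (L u x)\<^sup>2) - 1)"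
      by (simp add: c_def EL2)
    also have "\<dots> \<le> r u"
      unfolding rL using N
      by (intro null.testing_lower_bound intL AB) (auto simp: L_def sum_nonneg prod_nonneg lr_nonneg)
    finally show ?thesis .
  qed
  have r_int: "integrable std_normal_distribution r"
    unfolding r_def g_def using measure_alt_law(1)[OF \<rho> B] by (intro Bochner_Integration.integrable_add integrable_mult_right Bochner_Integration.integrable_sum) auto
  \<comment> \<open>The null error is constant in \<open>u\<close> and integrates to itself; the
    other errors are mixtures over \<open>u\<close>.\<close>
  have "average_risk \<rho> C f = (\<integral>u. r u \<partial>std_normal_distribution)"
    using measure_alt_law[OF \<rho> B]
    by (simp add: average_risk_def r_def g_def A_def std.prob_space[simplified] flip: B_def N_def)
  \<comment> \<open>On \<open>W\<close> the integrand is at least \<open>c\<close>, and off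
    \<open>W\<close> it is at least 0, whatever the sign of \<open>c\<close>.\<close>
  also have "\<dots> \<ge> (\<integral>u. indicator W u * c \<partial>std_normal_distribution)"
  proof (rule integral_mono[OF _ r_int])
    show "integrable std_normal_distribution (\<lambda>u. indicator W u * c)"
      by (intro integrable_mult_left integrable_real_indicator) (simp_all add: std.emeasure_eq_measure)
    show "indicator W u * c \<le> r u" for u
      using r0[of u] rc[of u] by (auto simp: W_def indicator_def)
  qed
  also have "(\<integral>u. indicator W u * c \<partial>std_normal_distribution) = measure std_normal_distribution W * c"
    by simp
  finally show ?thesis by (simp add: c_def W_def)
qed

theorem theorem2p1:
  fixes k :: nat and \<rho> :: real and C :: "('n::finite) set set"
  assumes "1 \<le> k" and "k \<le> CARD('n)"
    and "0 < \<rho>" and "\<rho> < 1"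
    and "C \<noteq> {}" and "\<And>S. S \<in> C \<Longrightarrow> card S = k"
  shows "(\<forall>a>0. bayes_risk \<rho> C \<ge>
            measure std_normal_distribution {x. \<bar>x\<bar> \<le> a} *
            (1 - 1/2 * sqrt (measure_pmf.expectation (overlap_pmf C)
                               (\<lambda>z. exp (nu \<rho> a * real z)) - 1)))
       \<and> bayes_risk \<rho> C \<ge>
            0.6 - 0.3 * sqrt (measure_pmf.expectation (overlap_pmf C)
              (\<lambda>z. exp ((\<rho> / (1 + \<rho>) - 1/2 * ln (1 - \<rho>\<^sup>2)) * real z)) - 1)"
proof -
  have main: "measure std_normal_distribution {x. \<bar>x\<bar> \<le> a} *
      (1 - 1/2 * sqrt (measure_pmf.expectation (overlap_pmf C) (\<lambda>z. exp (nu \<rho> a * real z)) - 1))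
    \<le> bayes_risk \<rho> C" for a
    by (intro bayes_risk_greatest average_risk_lower_bound assms)
  define c where "c = 1 - 1/2 * sqrt (measure_pmf.expectation (overlap_pmf C) (\<lambda>z. exp (nu \<rho> 1 * real z)) - 1)"
  have "0.6 * c \<le> bayes_risk \<rho> C"
  \<comment> \<open>Lowering the probability to 0.6 preserves the bound only for nonnegative
    \<open>c\<close>. For negative \<open>c\<close> the claim follows because the risk is
    nonnegative.\<close>
  proof (cases "0 \<le> c")
    case True
    then show ?thesis
      using mult_right_mono[OF std_normal_prob_abs_le_1 True] main[of 1] by (simp add: c_def)
  next
    case False
    then show ?thesis
      using bayes_risk_greatest[of 0 \<rho> C] average_risk_nonneg by (meson le_cases mult_nonneg_nonpos order_trans zero_le_divide_iff zero_le_numeral)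
  qed
  moreover have "nu \<rho> 1 = \<rho> / (1 + \<rho>) - 1/2 * ln (1 - \<rho>\<^sup>2)"
    by (simp add: nu_def)
  ultimately show ?thesis
    using main by (simp add: c_def algebra_simps)
qed

end
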